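(* Let $\{x_n\}_{n\ge 1}$ and $\{y_n\}_{n\ge 1}$ be two sequences of real numbers, with $y_n\neq 0$ for all sufficiently large $n$, such that $x_n\sim y_n$ (that is, $x_n/y_n\to 1$ as $n\to\infty$). Suppose that, as $n\to+\infty$, $$\frac{x_n}{y_n}\cdot\frac{x_{n-1}}{y_{n-1}}=\sum_{j=0}^{\infty}\frac{a_j}{n^j},\quad a_0=1,\qquad x_n=y_n\left(\sum_{j=0}^{\infty}\frac{b_j}{n^j}\right),$$ where $(a_j)_{j\ge 0}$ and $(b_j)_{j\ge 0}$ are real sequences and both expansions are understood as asymptotic power series. Then the coefficients $b_j$ are given by the recursive formula $$b_0=1,\qquad b_1=\frac{a_1}{2},\qquad b_k=\frac12\left(a_k-\sum_{i=1}^{k-1}b_{k-i}c_i-\sum_{j=1}^{k-1}\binom{k-1}{j-1}b_j\right),\quad k\ge 2,$$ where $c_0=1$ and $$c_i=\sum_{j=1}^{i}\binom{i-1}{j-1}b_j,\quad i=1,2,\ldots,k-1.$$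
   Context: An expansion $u_n=\sum_{j=0}^{\infty}\frac{a_j}{n^j}$ as $n\to+\infty$ is an asymptotic power series: for every integer $m\ge 0$, $u_n=\sum_{j=0}^{m}\frac{a_j}{n^j}+o\left(\frac{1}{n^m}\right)$ as $n\to\infty$ (convergence of the infinite series is not required). The relation $x_n=y_n\left(\sum_{j=0}^{\infty}\frac{b_j}{n^j}\right)$ means that $x_n/y_n$ has the asymptotic power series $\sum_{j=0}^{\infty}\frac{b_j}{n^j}$. *)

theory Defs
  imports Complex_Main "HOL-Library.Landau_Symbols"
begin

text \<open>
  The series is a formal object: no convergence of \<open>\<Sum>j. a j / n ^ j\<close> is required.
  The values of \<open>u\<close> at finitely many indices (in particular at \<open>0\<close>) play no role.
\<close>
definition has_asymp_power_series :: "(nat \<Rightarrow> real) \<Rightarrow> (nat \<Rightarrow> real) \<Rightarrow> bool" where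
  "has_asymp_power_series u a \<longleftrightarrow>
     (\<forall>m. (\<lambda>n. u n - (\<Sum>j\<le>m. a j / real n ^ j)) \<in> o(\<lambda>n. 1 / real n ^ m))"

text \<open>
  For \<open>i \<ge> 1\<close> this is the coefficient of \<open>1 / n ^ i\<close> in the expansion of
  \<open>\<Sum>j. b j / (n - 1) ^ j\<close> in powers of \<open>1 / n\<close>.
\<close>
definition shift_coeff :: "(nat \<Rightarrow> real) \<Rightarrow> nat \<Rightarrow> real" where
  "shift_coeff b i =
     (if i = 0 then 1 else (\<Sum>j=1..i. real ((i - 1) choose (j - 1)) * b j))"

end

theory Submission
  imports Defs "HOL-Real_Asymp.Real_Asymp"
begin

text \<open>
  Put \<open>u n = x n / y n\<close>. The hypotheses expand both \<open>u n\<close> and \<open>u n * u (n - 1)\<close>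
  in powers of \<open>1 / n\<close>, and the recursion expresses that these two expansions are compatible.
  Three facts about asymptotic power series give it. Coefficients are unique
  (\<open>asymp_power_series_unique\<close>). A product is expanded by the Cauchy product
  (\<open>asymp_power_series_mult\<close>). An expansion of \<open>u n\<close> yields one of \<open>u (n - 1)\<close>
  (\<open>asymp_power_series_shift\<close>), because for \<open>j \<ge> 1\<close> the power \<open>1 / (n - 1) ^ j\<close> has the
  expansion \<open>\<Sum>i\<ge>j. (i - 1 choose (j - 1)) / n ^ i\<close>; once \<open>b 0 = 1\<close> is known, the coefficients
  of \<open>u (n - 1)\<close> are \<open>shift_coeff b\<close>.

  Comparing coefficients of \<open>1 / n ^ k\<close> therefore gives
  \<open>a k = (\<Sum>i\<le>k. b (k - i) * shift_coeff b i)\<close>. For \<open>k \<ge> 1\<close> the unknown \<open>b k\<close> occurs in it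
  exactly twice with factor \<open>1\<close>: in the term \<open>i = 0\<close>, and as the last summand of
  \<open>shift_coeff b k\<close>. Solving for \<open>b k\<close> is the recursion.
\<close>

lemma asymp_power_seriesD:
  "has_asymp_power_series u a \<Longrightarrow>
     (\<lambda>n. u n - (\<Sum>j\<le>m. a j / real n ^ j)) \<in> o(\<lambda>n. 1 / real n ^ m)"
  by (simp add: has_asymp_power_series_def)

lemma inverse_power_smallo:
  assumes "m < k"
  shows "(\<lambda>n. c / real n ^ k) \<in> o(\<lambda>n. 1 / real n ^ m)"
proof -
  obtain d where k: "k = m + Suc d"
    using assms less_iff_Suc_add by auto
  have "(\<lambda>n. 1 / real n ^ Suc d) \<longlonglongrightarrow> 0"
    by real_asymp
  then have "(\<lambda>n. 1 / real n ^ Suc d) \<in> o(\<lambda>_. 1)"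
    by (intro smalloI_tendsto) auto
  from landau_o.small.mult_left[OF this, of "\<lambda>n. 1 / real n ^ m"]
  have "(\<lambda>n. 1 / real n ^ k) \<in> o(\<lambda>n. 1 / real n ^ m)"
    by (simp add: k power_add mult_ac)
  then have "(\<lambda>n. c * (1 / real n ^ k)) \<in> o(\<lambda>n. 1 / real n ^ m)"
    by (cases "c = 0") (simp_all del: times_divide_eq_right)
  then show ?thesis by simp
qed

lemma inverse_power_bounded: "(\<lambda>n. c / real n ^ k) \<in> O(\<lambda>_. 1)"
  using inverse_power_smallo[of 0 k c]
  by (cases "k = 0") (auto dest: landau_o.small_imp_big)

lemma truncation_bounded: "(\<lambda>n. \<Sum>j\<le>m. a j / real n ^ j) \<in> O(\<lambda>_. 1)"
  by (intro big_sum_in_bigo inverse_power_bounded)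

lemma asymp_power_series_bounded:
  assumes "has_asymp_power_series u a"
  shows "u \<in> O(\<lambda>_. 1)"
proof -
  have "(\<lambda>n. u n - a 0) \<in> O(\<lambda>_. 1)"
    using asymp_power_seriesD[OF assms, of 0] by (auto dest: landau_o.small_imp_big)
  from sum_in_bigo(1)[OF this, of "\<lambda>_. a 0"] show ?thesis by simp
qed

lemma asymp_power_series_leading_limit:
  assumes "has_asymp_power_series u a"
  shows "u \<longlonglongrightarrow> a 0"
proof -
  have "(\<lambda>n. u n - a 0) \<longlonglongrightarrow> 0"
    using asymp_power_seriesD[OF assms, of 0] by (auto dest: smalloD_tendsto)
  then show ?thesis by (simp add: LIM_zero_iff)
qed

text \<open>
  If the coefficients agree below \<open>k\<close>, the difference of the two truncations at \<open>k\<close> is the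
  single term \<open>(b k - a k) / n ^ k\<close>, which is \<open>o(1 / n ^ k)\<close> only for \<open>a k = b k\<close>.
\<close>
lemma asymp_power_series_unique:
  assumes a: "has_asymp_power_series u a" and b: "has_asymp_power_series u b"
  shows "a k = b k"
proof (induction k rule: less_induct)
  case (less k)
  have "(\<lambda>n. (u n - (\<Sum>j\<le>k. a j / real n ^ j)) - (u n - (\<Sum>j\<le>k. b j / real n ^ j)))
          \<in> o(\<lambda>n. 1 / real n ^ k)"
    by (intro sum_in_smallo asymp_power_seriesD a b)
  moreover have "(\<Sum>j<k. a j / real n ^ j) = (\<Sum>j<k. b j / real n ^ j)" for n
    by (intro sum.cong) (auto simp: less)
  ultimately have "(\<lambda>n. (b k - a k) * (1 / real n ^ k)) \<in> o(\<lambda>n. 1 / real n ^ k)"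
    by (simp add: lessThan_Suc_atMost[symmetric] diff_divide_distrib)
  then have "(\<lambda>n. ((b k - a k) * (1 / real n ^ k)) / (1 / real n ^ k)) \<longlonglongrightarrow> 0"
    by (rule smalloD_tendsto)
  moreover have "eventually (\<lambda>n. ((b k - a k) * (1 / real n ^ k)) / (1 / real n ^ k) = b k - a k)
      sequentially"
    using eventually_gt_at_top[of 0] by eventually_elim simp
  ultimately have "(\<lambda>n::nat. b k - a k) \<longlonglongrightarrow> 0"
    using tendsto_cong by fast
  then show ?case by (simp add: LIMSEQ_const_iff)
qed

text \<open>
  Both factors may be replaced by their truncations at \<open>m\<close>, since each factor and each
  truncation is bounded. In the product of the two truncations only the terms with
  \<open>i + j \<le> m\<close> matter: every other one is \<open>O(1 / n ^ (m + 1))\<close>.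
\<close>
lemma asymp_power_series_mult:
  assumes u: "has_asymp_power_series u a" and v: "has_asymp_power_series v b"
  shows "has_asymp_power_series (\<lambda>n. u n * v n) (\<lambda>k. \<Sum>i\<le>k. a (k - i) * b i)"
  unfolding has_asymp_power_series_def
proof
  fix m
  define P where "P = (\<lambda>n. \<Sum>j\<le>m. a j / real n ^ j)"
  define Q where "Q = (\<lambda>n. \<Sum>j\<le>m. b j / real n ^ j)"
  define L where "L = {(i, j). i + j \<le> m}"
  define H where "H = {..m} \<times> {..m} - L"
  let ?t = "\<lambda>p n. case p of (i, j) \<Rightarrow> (a i * b j) / real n ^ (i + j)"
  have "L \<subseteq> {..m} \<times> {..m}" by (auto simp: L_def)
  have PQ: "P n * Q n = (\<Sum>p\<in>L. ?t p n) + (\<Sum>p\<in>H. ?t p n)" for n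
  proof -
    have "P n * Q n = (\<Sum>p\<in>{..m} \<times> {..m}. ?t p n)"
      by (simp add: P_def Q_def sum_product sum.cartesian_product power_add case_prod_beta)
    also have "\<dots> = (\<Sum>p\<in>H. ?t p n) + (\<Sum>p\<in>L. ?t p n)"
      unfolding H_def by (intro sum.subset_diff \<open>L \<subseteq> _\<close>) auto
    finally show ?thesis by simp
  qed
  have L: "(\<Sum>k\<le>m. (\<Sum>i\<le>k. a (k - i) * b i) / real n ^ k) = (\<Sum>p\<in>L. ?t p n)" for n
  proof -
    have "(\<Sum>p\<in>L. ?t p n) = (\<Sum>k\<le>m. \<Sum>i\<le>k. (a i * b (k - i)) / real n ^ k)"
      using sum.triangle_reindex_eq[of "\<lambda>i j. ?t (i, j) n" m]
      by (simp add: L_def)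
    also have "\<dots> = (\<Sum>k\<le>m. \<Sum>i\<le>k. (a (k - i) * b i) / real n ^ k)"
    proof (rule sum.cong[OF refl])
      fix k
      show "(\<Sum>i\<le>k. (a i * b (k - i)) / real n ^ k) = (\<Sum>i\<le>k. (a (k - i) * b i) / real n ^ k)"
        by (rule sum.reindex_bij_witness[of _ "\<lambda>i. k - i" "\<lambda>i. k - i"]) auto
    qed
    finally show ?thesis by (simp add: sum_divide_distrib)
  qed
  have "(\<lambda>n. u n * (v n - Q n)) \<in> o(\<lambda>n. 1 * (1 / real n ^ m))"
    unfolding Q_def
    by (intro landau_o.big_small_mult asymp_power_series_bounded[OF u] asymp_power_seriesD v)
  moreover have "(\<lambda>n. Q n * (u n - P n)) \<in> o(\<lambda>n. 1 * (1 / real n ^ m))"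
    unfolding Q_def P_def
    by (intro landau_o.big_small_mult truncation_bounded asymp_power_seriesD u)
  moreover have "(\<lambda>n. \<Sum>p\<in>H. ?t p n) \<in> o(\<lambda>n. 1 / real n ^ m)"
  proof (rule big_sum_in_smallo)
    fix p assume "p \<in> H"
    then show "?t p \<in> o(\<lambda>n. 1 / real n ^ m)"
      by (auto simp: H_def L_def intro!: inverse_power_smallo)
  qed
  ultimately have "(\<lambda>n. u n * (v n - Q n) + Q n * (u n - P n) + (\<Sum>p\<in>H. ?t p n))
      \<in> o(\<lambda>n. 1 / real n ^ m)"
    by (intro sum_in_smallo) simp_all
  moreover have "u n * (v n - Q n) + Q n * (u n - P n) + (\<Sum>p\<in>H. ?t p n)
      = u n * v n - (\<Sum>k\<le>m. (\<Sum>i\<le>k. a (k - i) * b i) / real n ^ k)" for n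
    using PQ[of n] unfolding L by (simp add: algebra_simps)
  ultimately show "(\<lambda>n. u n * v n - (\<Sum>k\<le>m. (\<Sum>i\<le>k. a (k - i) * b i) / real n ^ k))
      \<in> o(\<lambda>n. 1 / real n ^ m)"
    by simp
qed

text \<open>
  The coefficient of \<open>X ^ i\<close> in \<open>(X / (1 - X)) ^ j\<close>. With \<open>X = 1 / n\<close> this power is
  \<open>1 / (n - 1) ^ j\<close>.
\<close>
definition geom_power_coeff :: "nat \<Rightarrow> nat \<Rightarrow> real" where
  "geom_power_coeff j i =
     (if j = 0 then if i = 0 then 1 else 0
      else if i = 0 then 0 else real ((i - 1) choose (j - 1)))"

text \<open>
  Multiplication by \<open>X / (1 - X) = X + X ^ 2 + \<dots>\<close> sums the coefficients strictly below
  the index, so consecutive coefficients differ as in Pascal's rule.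
\<close>
lemma geom_power_coeff_Suc:
  "geom_power_coeff (Suc j) k =
     (\<Sum>i\<le>k. geom_power_coeff 1 (k - i) * geom_power_coeff j i)"
proof -
  have "geom_power_coeff (Suc j) k = (\<Sum>i<k. geom_power_coeff j i)"
  proof (induction k)
    case 0
    show ?case by (simp add: geom_power_coeff_def)
  next
    case (Suc k)
    have "geom_power_coeff (Suc j) (Suc k) = geom_power_coeff (Suc j) k + geom_power_coeff j k"
      by (cases j; cases k) (auto simp: geom_power_coeff_def)
    with Suc show ?case by simp
  qed
  also have "\<dots> = (\<Sum>i<k. geom_power_coeff 1 (k - i) * geom_power_coeff j i)"
    by (intro sum.cong) (auto simp: geom_power_coeff_def)
  also have "\<dots> = (\<Sum>i\<le>k. geom_power_coeff 1 (k - i) * geom_power_coeff j i)"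
    by (simp add: lessThan_Suc_atMost[symmetric] geom_power_coeff_def)
  finally show ?thesis .
qed

text \<open>
  The truncated geometric series leaves the exact remainder \<open>1 / (n ^ m * (n - 1))\<close>.
\<close>
lemma asymp_power_series_inverse_pred:
  "has_asymp_power_series (\<lambda>n. 1 / real (n - 1)) (geom_power_coeff 1)"
  unfolding has_asymp_power_series_def
proof
  fix m
  have rem: "1 / real (n - 1) - (\<Sum>j\<le>m. geom_power_coeff 1 j / real n ^ j)
      = 1 / real (n - 1) * (1 / real n ^ m)" if "n > 1" for n
  proof (induction m)
    case 0
    show ?case by (simp add: geom_power_coeff_def)
  next
    case (Suc m)
    have "1 / real (n - 1) - (\<Sum>j\<le>Suc m. geom_power_coeff 1 j / real n ^ j)
        = 1 / real (n - 1) * (1 / real n ^ m) - 1 / real n ^ Suc m"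
      using Suc by (simp add: geom_power_coeff_def)
    also have "\<dots> = 1 / real (n - 1) * (1 / real n ^ Suc m)"
      using that by (simp add: of_nat_diff field_simps)
    finally show ?case .
  qed
  have "(\<lambda>n. 1 / real (n - 1)) \<longlonglongrightarrow> 0"
    by real_asymp
  then have "(\<lambda>n. 1 / real (n - 1)) \<in> o(\<lambda>_. 1)"
    by (intro smalloI_tendsto) auto
  from landau_o.small.mult_right[OF this, of "\<lambda>n. 1 / real n ^ m"]
  have "(\<lambda>n. 1 / real (n - 1) * (1 / real n ^ m)) \<in> o(\<lambda>n. 1 / real n ^ m)"
    by simp
  moreover have "eventually (\<lambda>n. 1 / real (n - 1) * (1 / real n ^ m)
      = 1 / real (n - 1) - (\<Sum>j\<le>m. geom_power_coeff 1 j / real n ^ j)) sequentially"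
    using eventually_gt_at_top[of 1] by eventually_elim (simp only: rem)
  ultimately show "(\<lambda>n. 1 / real (n - 1) - (\<Sum>j\<le>m. geom_power_coeff 1 j / real n ^ j))
      \<in> o(\<lambda>n. 1 / real n ^ m)"
    using landau_o.small.in_cong by fast
qed

lemma asymp_power_series_inverse_pred_power:
  "has_asymp_power_series (\<lambda>n. 1 / real (n - 1) ^ j) (geom_power_coeff j)"
proof (induction j)
  case 0
  have "(\<Sum>i\<le>m. geom_power_coeff 0 i / real n ^ i) = 1" for n m
    by (induction m) (auto simp: geom_power_coeff_def)
  then show ?case by (simp add: has_asymp_power_series_def)
next
  case (Suc j)
  from asymp_power_series_mult[OF asymp_power_series_inverse_pred this]
  have "has_asymp_power_series (\<lambda>n. 1 / real (n - 1) * (1 / real (n - 1) ^ j)) (geom_power_coeff (Suc j))"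
    by (simp only: geom_power_coeff_Suc[symmetric])
  then show ?case by simp
qed

text \<open>
  Substituting \<open>n - 1\<close> into the truncation at \<open>m\<close> leaves an error \<open>o(1 / (n - 1) ^ m)\<close>,
  which is \<open>o(1 / n ^ m)\<close>; the finitely many powers \<open>1 / (n - 1) ^ j\<close> are then
  re-expanded one by one. As \<open>geom_power_coeff j i\<close> vanishes for \<open>j > i\<close>, the resulting
  coefficients do not depend on \<open>m\<close>.
\<close>
lemma asymp_power_series_shift:
  assumes u: "has_asymp_power_series u b"
  shows "has_asymp_power_series (\<lambda>n. u (n - 1)) (\<lambda>i. \<Sum>j\<le>i. b j * geom_power_coeff j i)"
  unfolding has_asymp_power_series_def
proof
  fix m
  let ?R = "\<lambda>j n. 1 / real (n - 1) ^ j - (\<Sum>i\<le>m. geom_power_coeff j i / real n ^ i)"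
  have "filterlim (\<lambda>n::nat. n - 1) sequentially sequentially"
    by (rule filterlim_minus_const_nat_at_top)
  from landau_o.small.compose[OF asymp_power_seriesD[OF u, of m] this]
  have "(\<lambda>n. u (n - 1) - (\<Sum>j\<le>m. b j / real (n - 1) ^ j)) \<in> o(\<lambda>n. 1 / real (n - 1) ^ m)" .
  moreover have "(\<lambda>n. 1 / real (n - 1) ^ m) \<in> O(\<lambda>n. 1 / real n ^ m)"
  proof (rule bigoI)
    show "eventually (\<lambda>n. norm (1 / real (n - 1) ^ m) \<le> 2 ^ m * norm (1 / real n ^ m)) sequentially"
      using eventually_gt_at_top[of 1]
    proof eventually_elim
      case (elim n)
      \<comment> \<open>For \<open>n \<ge> 2\<close>, \<open>n \<le> 2 * (n - 1)\<close>.\<close>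
      have "real n ^ m \<le> (2 * real (n - 1)) ^ m"
        using elim by (intro power_mono) auto
      also have "\<dots> = 2 ^ m * real (n - 1) ^ m"
        by (rule power_mult_distrib)
      finally show ?case
        using elim by (simp add: divide_simps)
    qed
  qed
  ultimately have sub: "(\<lambda>n. u (n - 1) - (\<Sum>j\<le>m. b j / real (n - 1) ^ j)) \<in> o(\<lambda>n. 1 / real n ^ m)"
    by (rule landau_o.small_big_trans)
  have re: "(\<lambda>n. \<Sum>j\<le>m. b j * ?R j n) \<in> o(\<lambda>n. 1 / real n ^ m)"
  proof (rule big_sum_in_smallo)
    fix j
    show "(\<lambda>n. b j * ?R j n) \<in> o(\<lambda>n. 1 / real n ^ m)"
      using asymp_power_seriesD[OF asymp_power_series_inverse_pred_power[of j], of m]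
      by (cases "b j = 0") simp_all
  qed
  have coeffs: "(\<Sum>i\<le>m. (\<Sum>j\<le>i. b j * geom_power_coeff j i) / real n ^ i)
      = (\<Sum>j\<le>m. b j * (\<Sum>i\<le>m. geom_power_coeff j i / real n ^ i))" for n
  proof -
    have "(\<Sum>j\<le>i. b j * geom_power_coeff j i) = (\<Sum>j\<le>m. b j * geom_power_coeff j i)"
      if "i \<le> m" for i
      using that by (intro sum.mono_neutral_left) (auto simp: geom_power_coeff_def)
    then have "(\<Sum>i\<le>m. (\<Sum>j\<le>i. b j * geom_power_coeff j i) / real n ^ i)
        = (\<Sum>i\<le>m. \<Sum>j\<le>m. b j * geom_power_coeff j i / real n ^ i)"
      by (simp add: sum_divide_distrib)
    also have "\<dots> = (\<Sum>j\<le>m. \<Sum>i\<le>m. b j * geom_power_coeff j i / real n ^ i)"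
      by (rule sum.swap)
    finally show ?thesis by (simp add: sum_distrib_left)
  qed
  have total: "(u (n - 1) - (\<Sum>j\<le>m. b j / real (n - 1) ^ j)) + (\<Sum>j\<le>m. b j * ?R j n)
      = u (n - 1) - (\<Sum>i\<le>m. (\<Sum>j\<le>i. b j * geom_power_coeff j i) / real n ^ i)" for n
    unfolding coeffs by (simp add: right_diff_distrib sum_subtractf)
  from sum_in_smallo(1)[OF sub re]
  show "(\<lambda>n. u (n - 1) - (\<Sum>i\<le>m. (\<Sum>j\<le>i. b j * geom_power_coeff j i) / real n ^ i))
      \<in> o(\<lambda>n. 1 / real n ^ m)"
    unfolding total .
qed

lemma shift_coeff_eq_sum_geom_power_coeff:
  assumes "b 0 = 1"
  shows "(\<Sum>j\<le>i. b j * geom_power_coeff j i) = shift_coeff b i"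
proof (cases "i = 0")
  case True
  with assms show ?thesis by (simp add: shift_coeff_def geom_power_coeff_def)
next
  case False
  have "(\<Sum>j\<le>i. b j * geom_power_coeff j i) = (\<Sum>j=1..i. b j * geom_power_coeff j i)"
    using False by (intro sum.mono_neutral_right) (auto simp: geom_power_coeff_def)
  also have "\<dots> = shift_coeff b i"
    using False by (auto simp: shift_coeff_def geom_power_coeff_def intro!: sum.cong)
  finally show ?thesis .
qed

theorem theorem3p2:
  fixes x y a b :: "nat \<Rightarrow> real"
  assumes "eventually (\<lambda>n. y n \<noteq> 0) sequentially"
    and "(\<lambda>n. x n / y n) \<longlonglongrightarrow> 1"
    and "has_asymp_power_series (\<lambda>n. x n / y n * (x (n - 1) / y (n - 1))) a"
    and "a 0 = 1"
    and "has_asymp_power_series (\<lambda>n. x n / y n) b"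
  shows "b 0 = 1 \<and> b 1 = a 1 / 2 \<and>
    (\<forall>k\<ge>2. b k = 1 / 2 *
       (a k - (\<Sum>i=1..k-1. b (k - i) * shift_coeff b i)
            - (\<Sum>j=1..k-1. real ((k - 1) choose (j - 1)) * b j)))"
proof -
  have b0: "b 0 = 1"
    using asymp_power_series_leading_limit[OF assms(5)] assms(2) by (rule LIMSEQ_unique)
  have "has_asymp_power_series (\<lambda>n. x (n - 1) / y (n - 1)) (shift_coeff b)"
    using asymp_power_series_shift[OF assms(5)]
    by (simp add: shift_coeff_eq_sum_geom_power_coeff[of b, OF b0])
  from asymp_power_series_mult[OF assms(5) this]
  have coeff: "a k = (\<Sum>i\<le>k. b (k - i) * shift_coeff b i)" for k
    by (rule asymp_power_series_unique[OF assms(3)])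
  have solve: "2 * b k = a k - (\<Sum>i=1..k-1. b (k - i) * shift_coeff b i)
      - (\<Sum>j=1..k-1. real ((k - 1) choose (j - 1)) * b j)" if "1 \<le> k" for k
  proof -
    obtain l where k: "k = Suc l" using \<open>1 \<le> k\<close> by (cases k) auto
    have "a k = b k * shift_coeff b 0 + (\<Sum>i=1..l. b (k - i) * shift_coeff b i)
        + b 0 * shift_coeff b k"
      unfolding coeff[of k] by (simp add: k atMost_atLeast0 sum.atLeast_Suc_atMost)
    moreover have "shift_coeff b k = (\<Sum>j=1..l. real (l choose (j - 1)) * b j) + b k"
      by (simp add: shift_coeff_def k)
    moreover have "shift_coeff b 0 = 1"
      by (simp add: shift_coeff_def)
    ultimately show ?thesis by (simp add: b0 k)
  qed
  show ?thesis
  proof (intro conjI allI impI b0)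
    show "b 1 = a 1 / 2" using solve[of 1] by simp
  next
    fix k :: nat assume "k \<ge> 2"
    then show "b k = 1 / 2 *
       (a k - (\<Sum>i=1..k-1. b (k - i) * shift_coeff b i)
            - (\<Sum>j=1..k-1. real ((k - 1) choose (j - 1)) * b j))"
      using solve[of k] by simp
  qed
qed

end
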